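(* Let $S\subseteq\{0,1\}^\omega$ be such that for each function $f:\omega\to\bigcup_{n\in\omega}\{0,1\}^n$ there exists a sequence $\{a_n\}_{n\in\omega}$ belonging to $S$ such that for infinitely many $i\in\omega$ the infinite sequence $\{a_{i+n}\}_{n\in\omega}$ extends the finite sequence $f(i)$. Then $\mathrm{card}\, S\geq \mathrm{non}(\mathcal{M})$.
   Context: $\mathcal{M}$ denotes the ideal of first category subsets of $\mathbb{R}$, and $\mathrm{non}(\mathcal{M})=\min\{\mathrm{card}\, X: X\subseteq\mathbb{R},\ X\notin\mathcal{M}\}$. $\{0,1\}^n$ is the set of finite binary sequences of length $n$. An infinite sequence $\{b_n\}_{n\in\omega}$ extends a finite sequence $(s_0,\dots,s_{m-1})$ if $b_j=s_j$ for all $j<m$. *)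

theory Defs
  imports "HOL-Analysis.Analysis"
begin

unbundle cardinal_syntax

definition nowhere_dense :: "'a::topological_space set \<Rightarrow> bool" where
  "nowhere_dense A \<longleftrightarrow> interior (closure A) = {}"

definition first_category :: "'a::topological_space set \<Rightarrow> bool" where
  "first_category A \<longleftrightarrow>
     (\<exists>\<N>. countable \<N> \<and> (\<forall>N\<in>\<N>. nowhere_dense N) \<and> A = \<Union>\<N>)"

definition meager_ideal :: "real set set" where
  "meager_ideal = {A. first_category A}"

text \<open>The least cardinality of a set outside \<open>\<J>\<close>. Cardinals are well-order relations,
  determined only up to \<open>=o\<close>, so, as for \<open>cardSuc\<close>, a minimal one is chosen.\<close>

definition non :: "'a set set \<Rightarrow> 'a rel" where
  "non \<J> = (SOME r. (\<exists>X. X \<notin> \<J> \<and> r = |X| ) \<and> (\<forall>Y. Y \<notin> \<J> \<longrightarrow> r \<le>o |Y| ))"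

text \<open>The binary digits 0 and 1 are represented by type \<^typ>\<open>bool\<close>, and finite binary
  sequences of arbitrary length by \<^typ>\<open>bool list\<close>.\<close>

definition extends :: "(nat \<Rightarrow> bool) \<Rightarrow> bool list \<Rightarrow> bool" where
  "extends b s \<longleftrightarrow> (\<forall>j<length s. b j = s ! j)"

lemma non_attained_least:
  assumes "X0 \<notin> \<J>"
  shows "(\<exists>X. X \<notin> \<J> \<and> non \<J> = |X| ) \<and> (\<forall>Y. Y \<notin> \<J> \<longrightarrow> non \<J> \<le>o |Y| )"
proof -
  let ?R = "card_of ` (- \<J>)"
  from assms have "?R \<noteq> {}" by blast
  moreover have "\<forall>r\<in>?R. Card_order r" by (simp add: card_of_Card_order)
  ultimately have "\<exists>r\<in>?R. \<forall>r'\<in>?R. r \<le>o r'" by (rule exists_minim_Card_order)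
  then obtain X where X: "X \<notin> \<J>" "\<forall>r'\<in>?R. |X| \<le>o r'" by auto
  then have "(\<exists>X'. X' \<notin> \<J> \<and> |X| = |X'| ) \<and> (\<forall>Y. Y \<notin> \<J> \<longrightarrow> |X| \<le>o |Y| )" by auto
  then show ?thesis unfolding non_def by (rule someI)
qed

lemma UNIV_notin_meager_ideal: "UNIV \<notin> meager_ideal"
proof
  assume "UNIV \<in> meager_ideal"
  then obtain \<N> :: "real set set" where N: "countable \<N>" "\<forall>N\<in>\<N>. nowhere_dense N" "UNIV = \<Union>\<N>"
    unfolding meager_ideal_def first_category_def by blast
  let ?\<G> = "(\<lambda>N. - closure N) ` \<N>"
  have "UNIV \<subseteq> closure (\<Inter>?\<G>)"
  proof (rule Baire)
    fix T assume "T \<in> ?\<G>"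
    then show "openin (top_of_set UNIV) T \<and> UNIV \<subseteq> closure T"
      using N(2) by (auto simp: closure_complement nowhere_dense_def open_Compl)
  qed (use N(1) in auto)
  moreover have "\<Inter>?\<G> = {}" using N(3) closure_subset by blast
  ultimately show False by simp
qed

lemma non_meager_ideal:
  "\<exists>X. X \<notin> meager_ideal \<and> non meager_ideal = |X|"
  "Y \<notin> meager_ideal \<Longrightarrow> non meager_ideal \<le>o |Y|"
  using non_attained_least[OF UNIV_notin_meager_ideal] by blast+

end

theory Submission
  imports Defs
begin

text \<open>The set of reals whose binary expansions lie in \<open>S\<close> is not of first category. Given nowhere
  dense sets \<open>N j\<close>, for each \<open>i\<close> there is a single word \<open>f i\<close> which, read at position \<open>i\<close> of a
  binary expansion, forces the real out of \<open>N 0, \<dots>, N i\<close> whatever the first \<open>i\<close> digits are: only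
  finitely many affine copies of these sets have to be avoided simultaneously. A sequence in \<open>S\<close>
  that meets \<open>f i\<close> at infinitely many positions \<open>i\<close> therefore represents a real outside
  \<open>\<Union>j. N j\<close>.\<close>

definition binary_real :: "(nat \<Rightarrow> bool) \<Rightarrow> real" where
  "binary_real a = (\<Sum>n. of_bool (a n) * (1/2) ^ Suc n)"

lemma summable_binary: "summable (\<lambda>n. of_bool (a n) * (1/2 :: real) ^ Suc n)"
proof (rule summable_comparison_test')
  show "summable (\<lambda>n. (1/2 :: real) ^ Suc n)"
    using power_half_series by (rule sums_summable)
qed auto

lemma binary_real_nonneg: "0 \<le> binary_real a"
  unfolding binary_real_def by (rule suminf_nonneg[OF summable_binary]) simp

lemma binary_real_le_1: "binary_real a \<le> 1"
proof -
  have "binary_real a \<le> (\<Sum>n. (1/2) ^ Suc n)"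
    unfolding binary_real_def
    by (rule suminf_le[OF _ summable_binary sums_summable[OF power_half_series]]) simp
  then show ?thesis using sums_unique[OF power_half_series] by simp
qed

text \<open>With the first \<open>i\<close> digits fixed, the real is an affine function of the real
  coded by the tail; this lets conditions on \<open>a\<close> be turned into conditions on the tail
  alone.\<close>

lemma binary_real_split:
  "binary_real a = (\<Sum>n<i. of_bool (a n) * (1/2) ^ Suc n) + binary_real (\<lambda>n. a (i + n)) / 2 ^ i"
proof -
  have "(\<Sum>n. of_bool (a (n + i)) * (1/2 :: real) ^ Suc (n + i))
      = (\<Sum>n. of_bool (a (i + n)) * (1/2) ^ Suc n / 2 ^ i)"
    by (rule suminf_cong) (simp add: power_add power_one_over add.commute)
  also have "\<dots> = binary_real (\<lambda>n. a (i + n)) / 2 ^ i"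
    unfolding binary_real_def by (rule suminf_divide[OF summable_binary])
  finally show ?thesis
    unfolding binary_real_def[of a] suminf_split_initial_segment[OF summable_binary, of a i]
    by simp
qed

text \<open>The common heads cancel, leaving a difference of two tails in [0,1], scaled by
  \<open>1 / 2 ^ m\<close>.\<close>

lemma binary_real_close:
  assumes "\<And>j. j < m \<Longrightarrow> a j = c j"
  shows "\<bar>binary_real a - binary_real c\<bar> \<le> (1/2) ^ m"
proof -
  let ?x = "binary_real (\<lambda>n. a (m + n))" and ?y = "binary_real (\<lambda>n. c (m + n))"
  have "binary_real a - binary_real c = (?x - ?y) / 2 ^ m"
    using assms by (simp add: binary_real_split[of a m] binary_real_split[of c m] diff_divide_distrib)
  moreover have "\<bar>?x - ?y\<bar> \<le> 1"
    using binary_real_nonneg[of "\<lambda>n. a (m + n)"] binary_real_le_1[of "\<lambda>n. a (m + n)"]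
      binary_real_nonneg[of "\<lambda>n. c (m + n)"] binary_real_le_1[of "\<lambda>n. c (m + n)"] by linarith
  ultimately show ?thesis by (simp add: power_one_over divide_right_mono)
qed

lemma binary_real_surj:
  assumes "0 \<le> z" "z < 1"
  obtains c where "binary_real c = z"
proof
  \<comment> \<open>The parity of the integer part of \<open>2 ^ Suc n * z\<close> is the digit of
    \<open>z\<close> with weight \<open>(1/2) ^ Suc n\<close>; the partial sums are then the
    truncations of \<open>z\<close> to \<open>n\<close> digits.\<close>
  define c where "c n = odd \<lfloor>2 ^ Suc n * z\<rfloor>" for n
  have partial: "(\<Sum>i<n. of_bool (c i) * (1/2) ^ Suc i) = real_of_int \<lfloor>2 ^ n * z\<rfloor> / 2 ^ n" for n
  proof (induction n)
    case 0
    have "\<lfloor>z\<rfloor> = 0" using assms by linarith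
    then show ?case by simp
  next
    case (Suc n)
    \<comment> \<open>Integer division by 2 drops the last binary digit, and the remainder is
      \<open>c n\<close>.\<close>
    have "\<lfloor>2 ^ Suc n * z\<rfloor> div 2 = \<lfloor>2 ^ n * z\<rfloor>"
      using floor_divide_real_eq_div[of 2 "2 ^ Suc n * z"] by simp
    then have "\<lfloor>2 ^ Suc n * z\<rfloor> = 2 * \<lfloor>2 ^ n * z\<rfloor> + of_bool (c n)"
      using div_mult_mod_eq[of "\<lfloor>2 ^ Suc n * z\<rfloor>" 2] by (simp add: c_def mod_2_eq_odd del: power_Suc)
    then have "real_of_int \<lfloor>2 ^ Suc n * z\<rfloor> = 2 * of_int \<lfloor>2 ^ n * z\<rfloor> + of_bool (c n)"
      by simp
    then show ?case
      unfolding sum.lessThan_Suc Suc.IH by (simp add: power_one_over field_simps)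
  qed
  have "(\<lambda>n. of_int \<lfloor>2 ^ n * z\<rfloor> / 2 ^ n) \<longlonglongrightarrow> z"
  proof (rule tendsto_sandwich)
    show "\<forall>\<^sub>F n in sequentially. z - (1/2) ^ n \<le> of_int \<lfloor>2 ^ n * z\<rfloor> / 2 ^ n"
    proof (rule always_eventually, rule allI)
      fix n
      have "2 ^ n * z - 1 \<le> of_int \<lfloor>2 ^ n * z\<rfloor>" by linarith
      then have "(2 ^ n * z - 1) / 2 ^ n \<le> of_int \<lfloor>2 ^ n * z\<rfloor> / 2 ^ n"
        by (rule divide_right_mono) simp
      then show "z - (1/2) ^ n \<le> of_int \<lfloor>2 ^ n * z\<rfloor> / 2 ^ n"
        by (simp add: power_one_over diff_divide_distrib)
    qed
    show "\<forall>\<^sub>F n in sequentially. of_int \<lfloor>2 ^ n * z\<rfloor> / 2 ^ n \<le> z"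
      by (rule always_eventually) (simp add: field_simps of_int_floor_le)
    have "(\<lambda>n. z - (1/2) ^ n) \<longlonglongrightarrow> z - 0"
      by (intro tendsto_intros LIMSEQ_power_zero) simp
    then show "(\<lambda>n. z - (1/2) ^ n) \<longlonglongrightarrow> z" by simp
  qed simp
  then have "(\<lambda>n. of_bool (c n) * (1/2) ^ Suc n) sums z"
    unfolding sums_def partial .
  then show "binary_real c = z"
    unfolding binary_real_def by (rule sums_unique[symmetric])
qed

text \<open>Closedness matters: rationals and irrationals both have empty interior but together fill
  the line.\<close>

lemma interior_UN_closed_empty:
  assumes "finite I" "\<And>i. i \<in> I \<Longrightarrow> closed (K i)" "\<And>i. i \<in> I \<Longrightarrow> interior (K i) = {}"
  shows "interior (\<Union>i\<in>I. K i) = {}"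
  using assms
proof (induction rule: finite_induct)
  case (insert i I)
  then show ?case
    using interior_closed_Un_empty_interior[of "K i" "\<Union>i\<in>I. K i"] by simp
qed simp

text \<open>An affine map of nonzero slope is open, so it would carry interior points of the
  preimage to interior points of \<open>A\<close>.\<close>

lemma interior_affine_vimage_empty:
  fixes A :: "real set"
  assumes "interior A = {}" "c \<noteq> 0"
  shows "interior ((\<lambda>x. p + c * x) -` A) = {}"
proof -
  let ?U = "interior ((\<lambda>x. p + c * x) -` A)"
  have "open ((\<lambda>x. p + c *\<^sub>R x) ` ?U)"
    using assms(2) by (intro open_affinity open_interior)
  moreover have "(\<lambda>x. p + c *\<^sub>R x) ` ?U \<subseteq> A"
    using interior_subset by fastforce
  ultimately show ?thesis
    using interior_maximal assms(1) by blast
qed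

text \<open>Some point \<open>z\<close> of the unit interval has a whole ball outside
  \<open>K\<close>; a long enough prefix of its expansion confines every extension to that
  ball.\<close>

lemma word_avoiding_closed:
  assumes "closed K" "interior K = {}"
  obtains w where "\<And>a. extends a w \<Longrightarrow> binary_real a \<notin> K"
proof -
  have "\<not> {0<..<1} \<subseteq> K"
    using interior_maximal[of "{0<..<1}" K] assms(2) by auto
  then obtain z where "z \<in> {0<..<1}" "z \<notin> K" by (meson subsetI)
  then have z: "0 < z" "z < 1" "z \<in> - K" by auto
  then obtain c where c: "binary_real c = z"
    using binary_real_surj[of z] by auto
  obtain e where e: "e > 0" "ball z e \<subseteq> - K"
    using assms(1) z(3) open_contains_ball by (metis open_Compl)
  obtain m where m: "(1/2 :: real) ^ m < e"
    using real_arch_pow_inv[OF e(1), of "1/2"] by auto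
  show thesis
  proof
    fix a assume "extends a (map c [0..<m])"
    then have "\<bar>binary_real a - z\<bar> \<le> (1/2) ^ m"
      unfolding c[symmetric] by (intro binary_real_close) (auto simp: extends_def)
    then have "binary_real a \<in> ball z e" using m by (simp add: dist_real_def)
    then show "binary_real a \<notin> K" using e(2) by blast
  qed
qed

lemma word_avoiding_nowhere_dense:
  assumes "\<And>j. nowhere_dense (N j)"
  obtains w where
    "\<And>a j. extends (\<lambda>n. a (i + n)) w \<Longrightarrow> j \<le> i \<Longrightarrow> binary_real a \<notin> N j"
proof -
  \<comment> \<open>\<open>p J\<close> is the contribution of a head whose ones are at the positions
    in \<open>J\<close>. Thus \<open>K (j, J)\<close> collects the tail values that such a head of
    length \<open>i\<close> sends into \<open>closure (N j)\<close>.\<close>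
  define p :: "nat set \<Rightarrow> real" where "p J = (\<Sum>n\<in>J. (1/2) ^ Suc n)" for J
  define K where
    "K = (\<lambda>(j, J). (\<lambda>x. p J + (1/2) ^ i * x) -` closure (N j))"
  let ?I = "{..i} \<times> Pow {..<i}"
  have K_closed: "closed (K q)" for q
    unfolding K_def by (cases q) (auto intro!: continuous_closed_vimage continuous_intros)
  have "interior (K q) = {}" for q
    using assms unfolding K_def nowhere_dense_def
    by (cases q) (simp add: interior_affine_vimage_empty)
  \<comment> \<open>There are only finitely many pairs of an index \<open>j\<close> up to
    \<open>i\<close> and a head of length \<open>i\<close>, so one word can serve them all.\<close>
  then have "interior (\<Union>q\<in>?I. K q) = {}"
    using K_closed by (intro interior_UN_closed_empty) auto
  moreover have "closed (\<Union>q\<in>?I. K q)"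
    using K_closed by (intro closed_UN) auto
  ultimately obtain w where w: "\<And>a. extends a w \<Longrightarrow> binary_real a \<notin> (\<Union>q\<in>?I. K q)"
    using word_avoiding_closed by metis
  show thesis
  proof
    fix a j assume ext: "extends (\<lambda>n. a (i + n)) w" and "j \<le> i"
    let ?J = "{n \<in> {..<i}. a n}"
    have "(j, ?J) \<in> ?I" using \<open>j \<le> i\<close> by auto
    then have "binary_real (\<lambda>n. a (i + n)) \<notin> K (j, ?J)"
      using w[OF ext] by blast
    moreover have "binary_real a = p ?J + (1/2) ^ i * binary_real (\<lambda>n. a (i + n))"
    proof -
      have "p ?J = (\<Sum>n<i. of_bool (a n) * (1/2) ^ Suc n)"
        unfolding p_def by (subst sum.inter_filter) (auto intro: sum.cong)
      then show ?thesis
        by (simp add: binary_real_split[of a i] power_one_over)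
    qed
    ultimately have "binary_real a \<notin> closure (N j)" by (simp add: K_def)
    then show "binary_real a \<notin> N j" using closure_subset by blast
  qed
qed

lemma binary_real_image_notin_meager_ideal:
  assumes "\<And>f :: nat \<Rightarrow> bool list. \<exists>a\<in>S. infinite {i. extends (\<lambda>n. a (i + n)) (f i)}"
  shows "binary_real ` S \<notin> meager_ideal"
proof
  assume "binary_real ` S \<in> meager_ideal"
  then obtain \<N> where \<N>: "countable \<N>" "\<And>N. N \<in> \<N> \<Longrightarrow> nowhere_dense N"
      "binary_real ` S = \<Union>\<N>"
    unfolding meager_ideal_def first_category_def by blast
  \<comment> \<open>Adding the empty set, itself nowhere dense, makes the family nonempty, so that
    it can be enumerated by all naturals.\<close>
  define N where "N = from_nat_into (insert {} \<N>)"
  have range_N: "range N = insert {} \<N>"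
    unfolding N_def using \<N>(1) by (simp add: range_from_nat_into)
  have "nowhere_dense (N j)" for j
    using rangeI[of N j] \<N>(2) unfolding range_N by (auto simp: nowhere_dense_def)
  then have "\<exists>w. \<forall>a j. extends (\<lambda>n. a (i + n)) w \<longrightarrow> j \<le> i \<longrightarrow> binary_real a \<notin> N j" for i
    using word_avoiding_nowhere_dense[of N i] by metis
  then obtain f where f:
    "\<And>i a j. extends (\<lambda>n. a (i + n)) (f i) \<Longrightarrow> j \<le> i \<Longrightarrow> binary_real a \<notin> N j"
    by metis
  obtain a where a: "a \<in> S" "infinite {i. extends (\<lambda>n. a (i + n)) (f i)}"
    using assms by blast
  have "binary_real a \<notin> N j" for j
  proof -
    \<comment> \<open>The word \<open>f i\<close> handles only the sets with index up to
      \<open>i\<close>, so an occurrence at or beyond \<open>j\<close> is required; infinitely many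
      occurrences supply one for every \<open>j\<close>.\<close>
    obtain i where "i \<ge> j" "extends (\<lambda>n. a (i + n)) (f i)"
      using a(2) unfolding infinite_nat_iff_unbounded_le by blast
    then show ?thesis using f by blast
  qed
  then have "binary_real a \<notin> \<Union>(range N)" by blast
  then show False using a(1) \<N>(3) unfolding range_N by auto
qed

theorem theorem2:
  fixes S :: "(nat \<Rightarrow> bool) set"
  assumes "\<And>f :: nat \<Rightarrow> bool list. \<exists>a\<in>S. infinite {i. extends (\<lambda>n. a (i + n)) (f i)}"
  shows "non meager_ideal \<le>o |S|"
proof -
  have "non meager_ideal \<le>o |binary_real ` S|"
    using assms by (intro non_meager_ideal(2) binary_real_image_notin_meager_ideal)
  \<comment> \<open>Dyadic rationals may have two expansions, so the image can only be smaller than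
    \<open>S\<close>, which is the right direction.\<close>
  also have "|binary_real ` S| \<le>o |S|"
    by (rule card_of_image)
  finally show ?thesis .
qed

end
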